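(* Let $\mathcal{H}$ be a hypergraph with $|V(\mathcal{H})|=n$ and $\sigma:[n]\to V(\mathcal{H})$ an arbitrary bijection. Let $d,q,t$ be positive integers with $q\geq(d-1)(t-1)+1$. Then any coloring of the vertices of $\operatorname{KG}(\mathcal{H})$ with no monochromatic $K_{t,t}$ uses at least $\min\{n-\operatorname{salt}(\mathcal{H},\sigma,q)+1,\ d\}$ colors.
   Context: $\operatorname{KG}(\mathcal{H})$ is the graph with vertex set $E(\mathcal{H})$, two edges of $\mathcal{H}$ adjacent iff disjoint. A $K_{t,t}$ in a graph is given by disjoint $t$-sets $W_1,W_2$ of vertices with every vertex of $W_1$ adjacent to every vertex of $W_2$; it is monochromatic if all its $2t$ vertices get the same color. $\mathcal{H}[S]$ is the induced subhypergraph on $S$ (edges of $\mathcal{H}$ contained in $S$). For $X=(x_1,\dots,x_n)\in\{+,-,0\}^n$, $X^\pm=\{i: x_i=\pm\}$ and $\operatorname{alt}(X)$ is the maximum length of a subsequence of nonzero entries (in increasing index order) with consecutive terms distinct ($\operatorname{alt}(0,\dots,0)=0$). $\operatorname{salt}(\mathcal{H},\sigma,q)=\max\{\operatorname{alt}(X): X\in\{+,-,0\}^n,\ \min_{\varepsilon\in\{+,-\}}|E(\mathcal{H}[\sigma(X^\varepsilon)])|\leq q-1\}$.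
   Formalization: The hypergraph is assumed to have at least one edge (with no edges the bound is 1 but 0 colors are used) and every edge is assumed non-empty (an empty edge can make salt undefined or the bound false). *)

theory Defs
  imports Main "HOL-Library.Sublist"
begin

text \<open>A hypergraph is given by its vertex set \<open>V\<close> and its edge set \<open>E\<close>; as usual, it is finite,
  without multiple edges, and every edge is non-empty.\<close>

definition hypergraph :: "'v set \<Rightarrow> 'v set set \<Rightarrow> bool" where
  "hypergraph V E \<longleftrightarrow> finite V \<and> E \<subseteq> Pow V \<and> {} \<notin> E"

definition induced_edges :: "'v set set \<Rightarrow> 'v set \<Rightarrow> 'v set set" where
  "induced_edges E S = {e \<in> E. e \<subseteq> S}"

text \<open>Graphs are pairs of a vertex set and a set of edges, an edge being an unordered pair of
  vertices.\<close>

type_synonym 'a graph = "'a set \<times> 'a set set"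

definition KG :: "'v set set \<Rightarrow> 'v set graph" where
  "KG E = (E, {{A, B} | A B. A \<in> E \<and> B \<in> E \<and> A \<inter> B = {}})"

definition is_Ktt :: "'a graph \<Rightarrow> nat \<Rightarrow> 'a set \<Rightarrow> 'a set \<Rightarrow> bool" where
  "is_Ktt G t W1 W2 \<longleftrightarrow>
     W1 \<subseteq> fst G \<and> W2 \<subseteq> fst G \<and> W1 \<inter> W2 = {} \<and>
     finite W1 \<and> card W1 = t \<and> finite W2 \<and> card W2 = t \<and>
     (\<forall>u\<in>W1. \<forall>w\<in>W2. {u, w} \<in> snd G)"

definition monochromatic :: "('a \<Rightarrow> 'c) \<Rightarrow> 'a set \<Rightarrow> bool" where
  "monochromatic c W \<longleftrightarrow> (\<exists>k. \<forall>w\<in>W. c w = k)"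

datatype sign = Plus | Minus | Zero

text \<open>A vector \<open>X = (x\<^sub>1, \<dots>, x\<^sub>n)\<close> is a list of length \<open>n\<close>, so \<open>x\<^sub>i\<close> is \<open>X ! (i - 1)\<close>; the set
  \<open>{i. x\<^sub>i = \<epsilon>}\<close> below keeps the 1-based indexing.\<close>

definition sign_set :: "sign \<Rightarrow> sign list \<Rightarrow> nat set" where
  "sign_set \<epsilon> X = {i \<in> {1..length X}. X ! (i - 1) = \<epsilon>}"

definition alt :: "sign list \<Rightarrow> nat" where
  "alt X = Max {length Y | Y. subseq Y X \<and> Zero \<notin> set Y \<and> distinct_adj Y}"

text \<open>The length \<open>n\<close> is the number of vertices, i.e. \<open>\<sigma>\<close> is meant to be a bijection from
  \<open>{1..n}\<close> onto the vertex set, which therefore need not be an argument. For a hypergraph and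
  \<open>q \<ge> 1\<close> the maximum is over a non-empty set, since the zero vector qualifies.\<close>

definition salt :: "nat \<Rightarrow> 'v set set \<Rightarrow> (nat \<Rightarrow> 'v) \<Rightarrow> nat \<Rightarrow> nat" where
  "salt n E \<sigma> q =
     Max {alt X | X. length X = n \<and>
            min (card (induced_edges E (\<sigma> ` sign_set Plus X)))
                (card (induced_edges E (\<sigma> ` sign_set Minus X))) \<le> q - 1}"

end

theory Submission
  imports Defs "HOL-Library.Multiset" "HOL-Library.Product_Lexorder"
begin

text \<open>Suppose that there are fewer than \<open>d\<close> colours and at most \<open>n - s\<close> of them, where
  \<open>s = salt(H, \<sigma>, q)\<close>. A nonzero sign vector \<open>X\<close> with \<open>alt X \<le> s\<close> is labelled by \<open>alt X\<close>
  together with its first nonzero sign. If \<open>alt X > s\<close>, both \<open>X\<^sup>+\<close> and \<open>X\<^sup>-\<close> contain at least \<open>q\<close>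
  edges, so by pigeonhole each of them contains \<open>t\<close> edges of one colour; the label is then \<open>s\<close> plus
  the largest colour occurring \<open>t\<close> times on some side, together with that side. No colour occurs \<open>t\<close>
  times on both sides, since this would be a monochromatic \<open>K\<^sub>t\<^sub>,\<^sub>t\<close>. Hence the labelling is
  antipodal without complementary comparable pairs, and Tucker's lemma for the octahedron yields at
  least \<open>n\<close> label magnitudes. Yet the two sides have different large colours, so the smallest colour
  is never the largest one and only \<open>s + C - 1 < n\<close> magnitudes occur, \<open>C\<close> being the number of colours.

  Tucker's lemma is obtained from Fan's parity argument: the number of maximal chains of signed sets
  whose labels, ordered by magnitude, alternate in sign starting with \<open>+\<close> is odd.\<close>

section \<open>Parity of alternating facets\<close>

fun alternating :: "bool \<Rightarrow> bool list \<Rightarrow> bool" where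
  "alternating b [] = True"
| "alternating b (x # xs) = (x = b \<and> alternating (\<not> b) xs)"

definition delete_at :: "nat \<Rightarrow> 'a list \<Rightarrow> 'a list" where
  "delete_at i xs = take i xs @ drop (Suc i) xs"

lemma delete_at_Cons_0 [simp]: "delete_at 0 (x # xs) = xs"
  by (simp add: delete_at_def)

lemma delete_at_Cons_Suc [simp]: "delete_at (Suc i) (x # xs) = x # delete_at i xs"
  by (simp add: delete_at_def)

lemma delete_at_map: "delete_at i (map f xs) = map f (delete_at i xs)"
  by (simp add: delete_at_def take_map drop_map)

lemma mset_delete_at: "i < length xs \<Longrightarrow> mset (delete_at i xs) = mset xs - {#xs ! i#}"
proof (induction xs arbitrary: i)
  case (Cons x xs)
  then show ?case by (cases i) auto
qed simp

lemma sorted_delete_at: "sorted xs \<Longrightarrow> sorted (delete_at i xs)"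
proof (induction xs arbitrary: i)
  case (Cons x xs)
  have "set (delete_at j xs) \<subseteq> set xs" for j
    by (auto simp: delete_at_def dest: in_set_takeD in_set_dropD)
  with Cons show ?case by (cases i) auto
qed (simp add: delete_at_def)

text \<open>Induction on the head \<open>x\<close>. Deleting \<open>x\<close> leaves
  \<open>xs\<close>; any other facet keeps \<open>x\<close>, which forces \<open>x = b\<close> and a
  remainder alternating from \<open>\<not> b\<close>. In that case the induction hypothesis for
  \<open>\<not> b\<close> cancels \<open>alternating b xs\<close> modulo 2; for
  \<open>x \<noteq> b\<close> only the first facet counts.\<close>

lemma alternating_facets_parity:
  "even ((\<Sum>i<length xs. of_bool (alternating b (delete_at i xs)))
     + (of_bool (alternating True xs) + of_bool (alternating False xs) :: nat))"
proof (induction xs arbitrary: b)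
  case (Cons x xs)
  have "(\<Sum>i<length (x # xs). of_bool (alternating b (delete_at i (x # xs))) :: nat)
    = of_bool (alternating b xs)
      + (\<Sum>i<length xs. of_bool (x = b \<and> alternating (\<not> b) (delete_at i xs)))"
    by (simp add: sum.lessThan_Suc_shift del: sum.lessThan_Suc)
  also have "\<dots> = of_bool (alternating b xs)
      + (if x = b then (\<Sum>i<length xs. of_bool (alternating (\<not> b) (delete_at i xs))) else 0)"
    by simp
  finally have sum_eq: "(\<Sum>i<length (x # xs). of_bool (alternating b (delete_at i (x # xs))) :: nat)
    = \<dots>" .
  show ?case
    unfolding sum_eq using Cons.IH[of "\<not> b"] by (cases b; cases x) (simp_all add: ac_simps)
qed simp

text \<open>The order on pairs is lexicographic: magnitude decides, and the sign only breaks
  ties.\<close>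

definition alternating_labels :: "bool \<Rightarrow> (nat \<times> bool) list \<Rightarrow> bool" where
  "alternating_labels b xs = alternating b (map snd (sort xs))"

text \<open>Whether a facet alternates depends only on the value removed from the multiset of
  labels, so one may sort first and delete afterwards. This reduces the count to plain sign
  lists.\<close>

lemma alternating_labels_facets_parity:
  fixes xs :: "(nat \<times> bool) list"
  shows "even ((\<Sum>i<length xs. of_bool (alternating_labels b (delete_at i xs)))
     + (of_bool (alternating_labels True xs) + of_bool (alternating_labels False xs) :: nat))"
proof -
  define g where "g x = (of_bool (alternating b (map snd
      (sorted_list_of_multiset (mset xs - {#x#})))) :: nat)" for x
  let ?ys = "sort xs"
  have "(\<Sum>i<length xs. of_bool (alternating_labels b (delete_at i xs)) :: nat)
      = (\<Sum>i<length xs. g (xs ! i))"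
    by (intro sum.cong refl)
      (simp add: g_def alternating_labels_def mset_delete_at
        flip: sorted_list_of_multiset_mset)
  also have "\<dots> = sum_list (map g xs)"
    by (simp add: sum_list_sum_nth atLeast0LessThan)
  also have "\<dots> = sum_list (map g ?ys)"
    by (metis mset_map mset_sort sum_mset_sum_list)
  also have "\<dots> = (\<Sum>i<length ?ys. g (?ys ! i))"
    by (simp add: sum_list_sum_nth atLeast0LessThan)
  also have "\<dots> = (\<Sum>i<length (map snd ?ys).
      of_bool (alternating b (delete_at i (map snd ?ys))))"
  proof (intro sum.cong)
    fix i assume "i \<in> {..<length (map snd ?ys)}"
    then have "i < length ?ys" by simp
    then have "mset xs - {#?ys ! i#} = mset (delete_at i ?ys)"
      by (simp add: mset_delete_at)
    moreover have "sort (delete_at i ?ys) = delete_at i ?ys"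
      by (simp add: sorted_delete_at sort_key_id_if_sorted)
    ultimately show "g (?ys ! i) = of_bool (alternating b (delete_at i (map snd ?ys)))"
      by (simp add: g_def delete_at_map)
  qed simp
  finally show ?thesis
    using alternating_facets_parity[of b "map snd ?ys"] by (simp add: alternating_labels_def)
qed

section \<open>The octahedral Tucker lemma\<close>

definition opp :: "nat \<times> bool \<Rightarrow> nat \<times> bool" where
  "opp p = (fst p, \<not> snd p)"

lemma opp_simps [simp]: "opp (opp p) = p" "fst (opp p) = fst p" "snd (opp p) = (\<not> snd p)"
    "opp p \<noteq> p" "p \<noteq> opp p" "opp (i, b) = (i, \<not> b)"
  by (auto simp: opp_def prod_eq_iff)

lemma mem_opp_image: "p \<in> opp ` X \<longleftrightarrow> opp p \<in> X"
  by (metis imageE imageI opp_simps(1))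

lemma alternating_not: "alternating b (map Not xs) = alternating (\<not> b) xs"
  by (induction xs arbitrary: b) auto

text \<open>Without opposite pairs, entries of equal magnitude coincide. Hence \<open>opp\<close> is
  monotone on the list and commutes with sorting.\<close>

lemma alternating_labels_opp:
  assumes "\<And>x. x \<in> set xs \<Longrightarrow> opp x \<notin> set xs"
  shows "alternating_labels b (map opp xs) = alternating_labels (\<not> b) xs"
proof -
  have "sorted (map opp (sort xs))"
    unfolding sorted_map
  proof (rule sorted_wrt_mono_rel[OF _ sorted_sort])
    fix x y assume "x \<in> set (sort xs)" "y \<in> set (sort xs)" "x \<le> y"
    moreover have "y \<noteq> opp x"
      using assms[of x] calculation(1,2) by (metis set_sort)
    moreover have "x = y" if "fst x = fst y"
      using that \<open>y \<noteq> opp x\<close> by (auto simp: opp_def prod_eq_iff)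
    ultimately show "opp x \<le> opp y" by (auto simp: less_eq_prod_def)
  qed
  then have "sort (map opp xs) = map opp (sort xs)"
    by (intro properties_for_sort) auto
  then have "map snd (sort (map opp xs)) = map Not (map snd (sort xs))"
    by simp
  then show ?thesis
    unfolding alternating_labels_def by (simp only: alternating_not)
qed

text \<open>Neighbours differ in sign, so equal magnitudes would make them opposite; magnitudes
  therefore increase strictly.\<close>

lemma sorted_alternating_distinct:
  fixes xs :: "(nat \<times> bool) list"
  assumes "sorted xs" "alternating b (map snd xs)"
    and "\<And>x. x \<in> set xs \<Longrightarrow> opp x \<notin> set xs"
  shows "distinct (map fst xs)"
  using assms
proof (induction xs arbitrary: b)
  case (Cons x xs)
  have "fst x < fst y" if "y \<in> set xs" for y
  proof -
    obtain z zs where xs: "xs = z # zs" using \<open>y \<in> set xs\<close> by (cases xs) auto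
    have "snd z = (\<not> snd x)" using Cons.prems(2) xs by auto
    moreover have "z \<noteq> opp x" using Cons.prems(3)[of x] xs by auto
    moreover have "x \<le> z" "z \<le> y" using Cons.prems(1) xs that by auto
    ultimately show ?thesis by (auto simp: less_eq_prod_def opp_def prod_eq_iff)
  qed
  moreover have "distinct (map fst xs)"
    using Cons.prems by (intro Cons.IH[of "\<not> b"]) auto
  ultimately show ?case by fastforce
qed simp

lemma even_card_involution:
  assumes "finite S" "\<And>x. x \<in> S \<Longrightarrow> f x \<in> S" "\<And>x. x \<in> S \<Longrightarrow> f (f x) = x"
    "\<And>x. x \<in> S \<Longrightarrow> f x \<noteq> x"
  shows "even (card S)"
  using assms
proof (induction S rule: finite_psubset_induct)
  case (psubset S)
  show ?case
  proof (cases "S = {}")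
    case False
    then obtain x where x: "x \<in> S" by blast
    let ?T = "S - {x, f x}"
    have "even (card ?T)"
    proof (rule psubset.IH)
      show "f y \<in> ?T" if "y \<in> ?T" for y
        using that x psubset.prems by (metis DiffE DiffI insertCI insertE singletonD)
    qed (use x psubset.prems in auto)
    moreover have "card S = card ?T + 2"
    proof -
      have "x \<noteq> f x" "f x \<in> S" using x psubset.prems by metis+
      then have "card {x, f x} = 2" "{x, f x} \<subseteq> S" using x by auto
      then show ?thesis
        using card_Diff_subset[of "{x, f x}" S] card_mono[of S "{x, f x}"] psubset.hyps by simp
    qed
    ultimately show ?thesis by simp
  qed simp
qed

section \<open>Signed sets and flags of the cross-polytope\<close>

definition signed_sets :: "nat \<Rightarrow> (nat \<times> bool) set set" where
  "signed_sets n = {X. fst ` X \<subseteq> {..<n} \<and> (\<forall>p\<in>X. opp p \<notin> X)}"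

text \<open>A flag \<open>[p\<^sub>1, \<dots>, p\<^sub>k]\<close> stands for the maximal chain \<open>{p\<^sub>1} \<subset> {p\<^sub>1, p\<^sub>2} \<subset> \<dots>\<close> of signed sets,
  i.e. a facet of the barycentric subdivision of the boundary of the cross-polytope.\<close>

definition flags :: "nat \<Rightarrow> (nat \<times> bool) list set" where
  "flags k = {L. distinct (map fst L) \<and> fst ` set L = {..<k}}"

lemma flags_length: "L \<in> flags k \<Longrightarrow> length L = k"
  unfolding flags_def
  by (metis (mono_tags, lifting) card_lessThan distinct_card length_map list.set_map mem_Collect_eq)

lemma finite_flags: "finite (flags k)"
proof (rule finite_subset)
  show "flags k \<subseteq> {L. set L \<subseteq> {..<k} \<times> UNIV \<and> length L = k}"
  proof
    fix L assume L: "L \<in> flags k"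
    then have "fst ` set L \<subseteq> {..<k}" by (simp add: flags_def)
    then show "L \<in> {L. set L \<subseteq> {..<k} \<times> UNIV \<and> length L = k}"
      using flags_length[OF L] by auto
  qed
qed (rule finite_lists_length_eq, simp)

lemma flags_0: "flags 0 = {[]}"
  by (auto simp: flags_def)

lemma flag_prefix_signed_set:
  assumes "L \<in> flags k" "k \<le> n"
  shows "set (take i L) \<in> signed_sets n"
proof -
  have "inj_on fst (set L)" using assms by (auto simp: flags_def distinct_map)
  then have "opp p \<notin> set L" if "p \<in> set L" for p
    using that by (metis inj_onD opp_simps(2,4))
  moreover have "fst ` set L \<subseteq> {..<n}" using assms by (auto simp: flags_def)
  ultimately show ?thesis
    unfolding signed_sets_def by (blast dest: in_set_takeD)
qed

lemma flag_opp: "L \<in> flags k \<Longrightarrow> map opp L \<in> flags k"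
  by (simp add: flags_def image_image comp_def)

text \<open>These are the hypotheses of Tucker's lemma on the barycentric subdivision of the
  cross-polytope boundary: its vertices are the nonempty signed sets, its edges the comparable
  pairs.\<close>

locale tucker_labelling =
  fixes n :: nat and lab :: "(nat \<times> bool) set \<Rightarrow> nat \<times> bool"
  assumes lab_opp: "X \<in> signed_sets n \<Longrightarrow> X \<noteq> {} \<Longrightarrow> lab (opp ` X) = opp (lab X)"
    and lab_compl: "X \<in> signed_sets n \<Longrightarrow> Y \<in> signed_sets n \<Longrightarrow> X \<noteq> {} \<Longrightarrow> X \<subseteq> Y
      \<Longrightarrow> lab Y \<noteq> opp (lab X)"
begin

definition labels :: "(nat \<times> bool) list \<Rightarrow> (nat \<times> bool) list" where
  "labels L = map (\<lambda>i. lab (set (take (Suc i) L))) [0..<length L]"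

lemma length_labels [simp]: "length (labels L) = length L"
  by (simp add: labels_def)

lemma labels_snoc: "labels (L @ [p]) = labels L @ [lab (set (L @ [p]))]"
  by (simp add: labels_def)

lemma labels_compl:
  assumes "L \<in> flags k" "k \<le> n" "x \<in> set (labels L)"
  shows "opp x \<notin> set (labels L)"
proof
  let ?S = "\<lambda>i. set (take (Suc i) L)"
  assume "opp x \<in> set (labels L)"
  with assms(3) obtain i j where ij: "x = lab (?S i)" "opp x = lab (?S j)"
      "i < length L" "j < length L"
    by (auto simp: labels_def)
  have ne: "?S i \<noteq> {}" "?S j \<noteq> {}" using ij by auto
  have S: "?S i \<in> signed_sets n" "?S j \<in> signed_sets n"
    using flag_prefix_signed_set assms by blast+
  consider "?S i \<subseteq> ?S j" | "?S j \<subseteq> ?S i"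
    using set_take_subset_set_take[of "Suc i" "Suc j" L] set_take_subset_set_take[of "Suc j" "Suc i" L]
    by linarith
  then show False
  proof cases
    case 1 then show ?thesis using lab_compl[OF S ne(1)] ij by simp
  next
    case 2 then show ?thesis using lab_compl[OF S(2,1) ne(2)] ij by (metis opp_simps(1))
  qed
qed

lemma labels_opp:
  assumes "L \<in> flags k" "k \<le> n"
  shows "labels (map opp L) = map opp (labels L)"
proof -
  have "lab (set (take (Suc i) (map opp L))) = opp (lab (set (take (Suc i) L)))" if "i < length L" for i
  proof -
    have "L \<noteq> []" using that by auto
    then show ?thesis
      using lab_opp[OF flag_prefix_signed_set[OF assms, of "Suc i"]] by (simp add: take_map)
  qed
  then show ?thesis by (simp add: labels_def)
qed

lemma delete_at_labels_cong:
  assumes "length L = length M"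
    and "\<And>j. j < length L \<Longrightarrow> j \<noteq> i \<Longrightarrow> set (take (Suc j) L) = set (take (Suc j) M)"
  shows "delete_at i (labels L) = delete_at i (labels M)"
proof -
  have "take i (labels L) = take i (labels M)"
    using assms by (intro nth_equalityI) (auto simp: labels_def)
  moreover have "drop (Suc i) (labels L) = drop (Suc i) (labels M)"
    using assms by (intro nth_equalityI) (auto simp: labels_def)
  ultimately show ?thesis by (simp add: delete_at_def)
qed

text \<open>The swap changes only the prefix of length \<open>i + 1\<close>, and the label of that
  prefix is the one deleted.\<close>

lemma delete_at_labels_swap:
  assumes "Suc i < length L"
  shows "delete_at i (labels (L[i := L ! Suc i, Suc i := L ! i])) = delete_at i (labels L)"
proof (rule delete_at_labels_cong)
  fix j assume j: "j < length (L[i := L ! Suc i, Suc i := L ! i])" "j \<noteq> i"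
  show "set (take (Suc j) (L[i := L ! Suc i, Suc i := L ! i])) = set (take (Suc j) L)"
  proof (cases "j < i")
    case True
    then show ?thesis by simp
  next
    case False
    let ?T = "take (Suc j) L"
    have "take (Suc j) (L[i := L ! Suc i, Suc i := L ! i]) = ?T[i := ?T ! Suc i, Suc i := ?T ! i]"
      using False j by (simp add: take_update_swap)
    moreover have "set (?T[i := ?T ! Suc i, Suc i := ?T ! i]) = set ?T"
      using False j assms by (intro set_swap) auto
    ultimately show ?thesis by simp
  qed
qed simp

lemma delete_at_labels_snoc: "length L = i \<Longrightarrow> delete_at i (labels (L @ [p])) = labels L"
  by (simp add: labels_snoc delete_at_def)

text \<open>The flags through \<open>(k, True)\<close> triangulate a hemisphere whose boundary is the sphere of one
  dimension less. Every facet of such a flag not on this boundary lies in exactly one other flag.\<close>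

lemma odd_card_alternating_flags:
  "k \<le> n \<Longrightarrow> odd (card {L \<in> flags k. alternating_labels True (labels L)})"
proof (induction k)
  case 0
  have "{L \<in> flags 0. alternating_labels True (labels L)} = {[]}"
    by (auto simp: flags_0 alternating_labels_def labels_def)
  then show ?case by simp
next
  case (Suc k)
  define G where "G = {L \<in> flags (Suc k). (k, True) \<in> set L}"
  have finG: "finite G" by (simp add: G_def finite_flags)
  let ?A = "\<lambda>b L. alternating_labels b (labels L)"
  let ?H = "{L \<in> flags (Suc k) - G. ?A True L}"
  have lenG: "length L = Suc k" if "L \<in> G" for L
    using that flags_length by (auto simp: G_def)
  \<comment> \<open>The antipodal map exchanges the two hemispheres and the two starting signs.
    Counting flags that start with \<open>True\<close> on the sphere thus becomes counting both
    kinds on \<open>G\<close>.\<close>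
  have bij: "bij_betw (map opp) ?H {L \<in> G. ?A False L}"
  proof (rule bij_betw_byWitness[where f' = "map opp"])
    have AF: "?A b (map opp L) = ?A (\<not> b) L" if "L \<in> flags (Suc k)" for b L
      using labels_opp[OF that Suc.prems] alternating_labels_opp[OF labels_compl[OF that Suc.prems]]
      by simp
    have G: "map opp L \<in> G \<longleftrightarrow> L \<notin> G" if "L \<in> flags (Suc k)" for L
    proof -
      have "k \<in> fst ` set L" using that by (auto simp: flags_def)
      then obtain b where b: "(k, b) \<in> set L" by auto
      have "inj_on fst (set L)" using that by (auto simp: flags_def distinct_map)
      then have "b' = b" if "(k, b') \<in> set L" for b' using that b by (metis fst_conv inj_onD snd_conv)
      then show ?thesis using b flag_opp[OF that] that
        by (cases b) (auto simp: G_def mem_opp_image)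
    qed
    show "map opp ` ?H \<subseteq> {L \<in> G. ?A False L}" using AF G by auto
    have "G \<subseteq> flags (Suc k)" by (auto simp: G_def)
    then show "map opp ` {L \<in> G. ?A False L} \<subseteq> ?H"
      using AF G flag_opp by (auto simp: subset_iff comp_def)
  qed (auto simp: comp_def)
  have "{L \<in> flags (Suc k). ?A True L} = {L \<in> G. ?A True L} \<union> ?H"
    by (auto simp: G_def)
  then have "card {L \<in> flags (Suc k). ?A True L} = card {L \<in> G. ?A True L} + card ?H"
    using finG finite_flags by (auto intro!: card_Un_disjoint)
  also have "\<dots> = card {L \<in> G. ?A True L} + card {L \<in> G. ?A False L}"
    using bij_betw_same_card[OF bij] by simp
  also have "\<dots> = (\<Sum>L\<in>G. of_bool (?A True L) + of_bool (?A False L))"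
    using finG by (simp add: sum.distrib of_bool_def flip: card_eq_sum sum.inter_filter)
  finally have card_eq: "card {L \<in> flags (Suc k). ?A True L}
      = (\<Sum>L\<in>G. of_bool (?A True L) + of_bool (?A False L))" .

  \<comment> \<open>Incidences between flags of \<open>G\<close> and their alternating facets.
    Counted flag by flag, they have the parity of the number sought; counted facet by facet, they
    lead to the induction hypothesis.\<close>
  define Q where "Q = {(L, i). L \<in> G \<and> i \<le> k \<and> alternating_labels True (delete_at i (labels L))}"
  \<comment> \<open>The facets on the boundary of the hemisphere: the full set is dropped, and the
    coordinate \<open>k\<close> was the last one added.\<close>
  define Q3 where "Q3 = {(L, i) \<in> Q. i = k \<and> fst (L ! k) = k}"
  have Q_Sigma: "Q = (SIGMA L:G. {i \<in> {..<Suc k}. alternating_labels True (delete_at i (labels L))})"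
    by (auto simp: Q_def)
  have finQ: "finite Q" unfolding Q_Sigma using finG by (intro finite_SigmaI) auto
  have "card Q = (\<Sum>L\<in>G. \<Sum>i<Suc k. of_bool (alternating_labels True (delete_at i (labels L))))"
    unfolding Q_Sigma using finG
    by (simp add: of_bool_def del: sum.lessThan_Suc flip: card_eq_sum sum.inter_filter)
  then have "card Q + card {L \<in> flags (Suc k). ?A True L} =
     (\<Sum>L\<in>G. (\<Sum>i<length (labels L). of_bool (alternating_labels True (delete_at i (labels L))))
        + (of_bool (?A True L) + of_bool (?A False L)))"
    using lenG by (simp add: card_eq sum.distrib del: sum.lessThan_Suc)
  also have "even \<dots>"
    by (intro dvd_sum alternating_labels_facets_parity)
  finally have parity: "even (card Q + card {L \<in> flags (Suc k). ?A True L})" .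

  \<comment> \<open>\<open>f\<close> passes to the other flag through the same facet: two
    consecutive entries trade places, or, if the full set is dropped, the last entry changes
    sign.\<close>
  define f where "f = (\<lambda>(L, i). (if i < k then L[i := L ! Suc i, Suc i := L ! i]
     else butlast L @ [opp (last L)], i))"
  have "even (card (Q - Q3))"
  proof (rule even_card_involution[where f = f])
    fix x assume x: "x \<in> Q - Q3"
    then obtain L i where x_def: "x = (L, i)" and L: "L \<in> G" and i: "i \<le> k"
        and alt: "alternating_labels True (delete_at i (labels L))"
        and nQ3: "i = k \<Longrightarrow> fst (L ! k) \<noteq> k"
      by (auto simp: Q_def Q3_def)
    have len: "length L = Suc k" using lenG L by simp
    have dist: "distinct (map fst L)" "distinct L" and fL: "fst ` set L = {..<Suc k}"
        and kL: "(k, True) \<in> set L"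
      using L by (auto simp: G_def flags_def distinct_map)
    have "f x \<in> Q - Q3 \<and> f (f x) = x \<and> f x \<noteq> x"
    proof (cases "i < k")
      case True
      let ?M = "L[i := L ! Suc i, Suc i := L ! i]"
      have fx: "f x = (?M, i)" using True by (simp add: f_def x_def)
      have S: "set ?M = set L" using True len by (intro set_swap) auto
      have "distinct (map fst ?M)"
        using distinct_swap[of i "map fst L" "Suc i"] True len dist by (simp add: map_update)
      then have "?M \<in> G" using S fL kL by (simp add: G_def flags_def)
      then have "f x \<in> Q - Q3"
        using delete_at_labels_swap[of i L] True len alt by (simp add: fx Q_def Q3_def)
      moreover have "f (f x) = x"
        using True len by (auto simp: fx x_def f_def intro!: nth_equalityI simp: nth_list_update)
      moreover have "?M \<noteq> L"
      proof
        assume "?M = L"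
        then have "?M ! i = L ! i" by simp
        then show False using True len dist by (simp add: nth_eq_iff_index_eq)
      qed
      ultimately show ?thesis by (metis fx x_def prod.inject)
    next
      case False
      then have ik: "i = k" using i by simp
      obtain N p where N: "L = N @ [p]" using len by (cases L rule: rev_cases) auto
      have lenN: "length N = k" using len N by simp
      have fx: "f x = (N @ [opp p], i)" using ik by (simp add: f_def x_def N)
      \<comment> \<open>Off the boundary the last entry is not in coordinate \<open>k\<close>, so
        reversing its sign keeps \<open>(k, True)\<close> and the flag stays in
        \<open>G\<close>.\<close>
      have "fst p \<noteq> k" using nQ3 ik N lenN by (simp add: nth_append)
      then have "(k, True) \<in> set N" using kL N by auto
      then have "N @ [opp p] \<in> G" using dist fL N by (simp add: G_def flags_def)
      then have "f x \<in> Q - Q3"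
        using alt \<open>fst p \<noteq> k\<close> lenN
        by (simp add: fx Q_def Q3_def ik N nth_append delete_at_labels_snoc)
      then show ?thesis using ik by (simp add: fx x_def f_def N)
    qed
    then show "f x \<in> Q - Q3" "f (f x) = x" "f x \<noteq> x" by auto
  qed (use finQ in simp)
  moreover have "card Q = card (Q - Q3) + card Q3"
  proof -
    have "Q3 \<subseteq> Q" by (auto simp: Q3_def)
    then show ?thesis
      using finQ card_Diff_subset[of Q3 Q] card_mono[of Q Q3] finite_subset by fastforce
  qed
  \<comment> \<open>Boundary facets are the alternating flags one dimension lower, whose number is
    odd by induction.\<close>
  moreover have "bij_betw (\<lambda>L. (L @ [(k, True)], k)) {L \<in> flags k. ?A True L} Q3"
  proof (rule bij_betw_byWitness[where f' = "\<lambda>(L, i). butlast L"])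
    show "(\<lambda>L. (L @ [(k, True)], k)) ` {L \<in> flags k. ?A True L} \<subseteq> Q3"
    proof
      fix x assume "x \<in> (\<lambda>L. (L @ [(k, True)], k)) ` {L \<in> flags k. ?A True L}"
      then obtain L where L: "x = (L @ [(k, True)], k)" "L \<in> flags k" "?A True L" by auto
      have len: "length L = k" using L flags_length by auto
      have "L @ [(k, True)] \<in> G"
        using L(2) by (auto simp: flags_def G_def lessThan_Suc)
      then show "x \<in> Q3"
        using L len by (simp add: Q3_def Q_def delete_at_labels_snoc nth_append)
    qed
    have Q3: "\<exists>N. x = (N @ [(k, True)], k) \<and> N \<in> flags k \<and> ?A True N" if x: "x \<in> Q3" for x
    proof -
      obtain L where L: "x = (L, k)" "L \<in> G" "alternating_labels True (delete_at k (labels L))"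
          "fst (L ! k) = k"
        using x by (auto simp: Q3_def Q_def)
      obtain N p where N: "L = N @ [p]" using lenG[OF L(2)] by (cases L rule: rev_cases) auto
      have lenN: "length N = k" using lenG[OF L(2)] N by simp
      have p: "fst p = k" using L(4) N lenN by (simp add: nth_append)
      have dist: "distinct (map fst (N @ [p]))" and fL: "fst ` set (N @ [p]) = {..<Suc k}"
          and kL: "(k, True) \<in> set (N @ [p])"
        using L(2) N by (auto simp: G_def flags_def)
      have kN: "k \<notin> fst ` set N" using dist p by auto
      then have "p = (k, True)" using kL by force
      moreover have "fst ` set N = {..<k}"
        using fL p kN insert_ident[of k "fst ` set N" "{..<k}"] by (simp add: lessThan_Suc)
      ultimately show ?thesis
        using L N dist lenN by (auto simp: flags_def delete_at_labels_snoc)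
    qed
    show "(\<lambda>(L, i). butlast L) ` Q3 \<subseteq> {L \<in> flags k. ?A True L}"
      using Q3 by fastforce
    show "\<forall>x\<in>Q3. ((case x of (L, i) \<Rightarrow> butlast L) @ [(k, True)], k) = x"
      using Q3 by fastforce
  qed simp
  ultimately have "odd (card Q)"
    using Suc bij_betw_same_card by fastforce
  then show ?case using parity by simp
qed

text \<open>An odd count yields an alternating flag; its \<open>n\<close> labels have distinct
  magnitudes, all in \<open>{1..m}\<close>.\<close>

theorem octahedral_tucker:
  assumes "\<And>X. X \<in> signed_sets n \<Longrightarrow> X \<noteq> {} \<Longrightarrow> fst (lab X) \<in> {1..m}"
  shows "n \<le> m"
proof -
  obtain L where L: "L \<in> flags n" "alternating_labels True (labels L)"
    using odd_card_imp_not_empty[OF odd_card_alternating_flags[OF order_refl]] by blast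
  have "distinct (map fst (sort (labels L)))"
    using L(2) labels_compl[OF L(1)] unfolding alternating_labels_def
    by (intro sorted_alternating_distinct[of _ True]) auto
  then have "card (fst ` set (labels L)) = n"
    using distinct_card[of "map fst (sort (labels L))"] flags_length[OF L(1)] by simp
  moreover have "fst ` set (labels L) \<subseteq> {1..m}"
  proof -
    have "set (take (Suc i) L) \<noteq> {}" if "i < length L" for i using that by auto
    then show ?thesis
      using assms flag_prefix_signed_set[OF L(1) order_refl] by (auto simp: labels_def)
  qed
  ultimately show ?thesis
    using card_mono[of "{1..m}" "fst ` set (labels L)"] by simp
qed

end

section \<open>Alternation of sign vectors\<close>

definition alternating_subseqs :: "sign list \<Rightarrow> sign list set" where
  "alternating_subseqs X = {Y. subseq Y X \<and> Zero \<notin> set Y \<and> distinct_adj Y}"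

lemma alt_eq_Max: "alt X = Max (length ` alternating_subseqs X)"
  unfolding alt_def alternating_subseqs_def by (rule arg_cong[where f = Max]) auto

lemma finite_length_alternating_subseqs: "finite (length ` alternating_subseqs X)"
  by (rule finite_subset[of _ "{..length X}"])
    (auto simp: alternating_subseqs_def dest: list_emb_length)

lemma length_le_alt: "Y \<in> alternating_subseqs X \<Longrightarrow> length Y \<le> alt X"
  unfolding alt_eq_Max by (intro Max_ge finite_length_alternating_subseqs imageI)

lemma alt_attained:
  obtains Y where "Y \<in> alternating_subseqs X" "length Y = alt X"
proof -
  have "[] \<in> alternating_subseqs X" by (simp add: alternating_subseqs_def)
  then have "alt X \<in> length ` alternating_subseqs X"
    unfolding alt_eq_Max by (intro Max_in finite_length_alternating_subseqs) blast
  then show ?thesis using that by auto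
qed

lemma alt_le_length: "alt X \<le> length X"
  using alt_attained[of X]
  by (metis (no_types, lifting) alternating_subseqs_def list_emb_length mem_Collect_eq)

section \<open>Sign reversal and the first nonzero sign\<close>

fun flip :: "sign \<Rightarrow> sign" where
  "flip Plus = Minus"
| "flip Minus = Plus"
| "flip Zero = Zero"

lemma flip_flip [simp]: "flip (flip x) = x"
  by (cases x) auto

lemma flip_eq_iff: "flip x = flip y \<longleftrightarrow> x = y"
  by (metis flip_flip)

lemma flip_eq_Zero_iff [simp]: "flip x = Zero \<longleftrightarrow> x = Zero" "Zero = flip x \<longleftrightarrow> x = Zero"
  by (cases x; simp)+

lemma alt_le_alt_flip: "alt X \<le> alt (map flip X)"
proof -
  obtain Y where Y: "Y \<in> alternating_subseqs X" "length Y = alt X" by (rule alt_attained)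
  then have "map flip Y \<in> alternating_subseqs (map flip X)"
    by (auto simp: alternating_subseqs_def subseq_map distinct_adj_map_iff inj_on_def flip_eq_iff)
  then show ?thesis using length_le_alt Y(2) by fastforce
qed

lemma alt_flip: "alt (map flip X) = alt X"
  using alt_le_alt_flip[of X] alt_le_alt_flip[of "map flip X"] by (simp add: comp_def)

fun first_sign :: "sign list \<Rightarrow> sign" where
  "first_sign [] = Zero"
| "first_sign (x # xs) = (if x = Zero then first_sign xs else x)"

lemma first_sign_flip: "first_sign (map flip X) = flip (first_sign X)"
  by (induction X) auto

lemma first_sign_eq_Zero_iff: "first_sign X = Zero \<longleftrightarrow> set X \<subseteq> {Zero}"
  by (induction X) auto

text \<open>A nonempty \<open>Y\<close> starts with a different sign, so it embeds strictly after
  the first nonzero entry of \<open>X\<close>, which can be put in front.\<close>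

lemma alternating_subseqs_Cons_first_sign:
  assumes "Y \<in> alternating_subseqs X" "Y = [] \<or> hd Y \<noteq> first_sign X" "first_sign X \<noteq> Zero"
  shows "first_sign X # Y \<in> alternating_subseqs X"
proof -
  have "subseq Y X" "Zero \<notin> set Y" "distinct_adj Y"
    using assms(1) by (auto simp: alternating_subseqs_def)
  from this(1) have "subseq (first_sign X # Y) X"
    using \<open>Zero \<notin> set Y\<close> assms(2,3)
  proof (induction X rule: list.induct)
    case (Cons x xs)
    then have "subseq Y xs"
      by (cases Y) (auto split: if_splits simp: subseq_Cons2_iff)
    then show ?case using Cons by auto
  qed simp
  then show ?thesis
    using \<open>Zero \<notin> set Y\<close> \<open>distinct_adj Y\<close> assms(2,3)
    by (cases Y) (auto simp: alternating_subseqs_def)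
qed

definition sign_le :: "sign \<Rightarrow> sign \<Rightarrow> bool" where
  "sign_le x y \<longleftrightarrow> x = Zero \<or> x = y"

lemma subseq_sign_le:
  assumes "list_all2 sign_le X Y" "subseq Z X" "Zero \<notin> set Z"
  shows "subseq Z Y"
  using assms
proof (induction X Y arbitrary: Z rule: list_all2_induct)
  case (Cons x xs y ys)
  show ?case
  proof (cases Z)
    case Z: (Cons z zs)
    show ?thesis
    proof (cases "z = x")
      case True
      then have "x = y" using Cons Z by (auto simp: sign_le_def)
      then show ?thesis using Cons True Z by auto
    next
      case False
      then show ?thesis using Cons Z by (metis list_emb_Cons subseq_Cons2_neq)
    qed
  qed simp
qed simp

text \<open>A longest alternating subsequence of \<open>X\<close> begins with
  \<open>first_sign X\<close>, since otherwise it could be prolonged. It survives in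
  \<open>Y\<close>, where the other sign can be prepended.\<close>

lemma alt_less_if_first_sign_differs:
  assumes le: "list_all2 sign_le X Y" and X: "first_sign X \<noteq> Zero" and Y: "first_sign Y \<noteq> Zero"
    and neq: "first_sign X \<noteq> first_sign Y"
  shows "alt X < alt Y"
proof -
  obtain Z where Z: "Z \<in> alternating_subseqs X" "length Z = alt X" by (rule alt_attained)
  have "Z \<noteq> [] \<and> hd Z = first_sign X"
  proof (rule ccontr)
    assume "\<not> (Z \<noteq> [] \<and> hd Z = first_sign X)"
    then have "first_sign X # Z \<in> alternating_subseqs X"
      using Z X by (intro alternating_subseqs_Cons_first_sign) auto
    then show False using length_le_alt Z(2) by fastforce
  qed
  moreover have "Z \<in> alternating_subseqs Y"
    using Z subseq_sign_le[OF le] by (auto simp: alternating_subseqs_def)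
  ultimately have "first_sign Y # Z \<in> alternating_subseqs Y"
    using neq Y by (intro alternating_subseqs_Cons_first_sign) auto
  then show ?thesis using length_le_alt Z(2) by fastforce
qed

lemma alt_pos:
  assumes "first_sign X \<noteq> Zero"
  shows "alt X \<ge> 1"
proof -
  have "[first_sign X] \<in> alternating_subseqs X"
    using assms by (intro alternating_subseqs_Cons_first_sign) (auto simp: alternating_subseqs_def)
  then show ?thesis using length_le_alt by fastforce
qed

section \<open>From signed sets to sign vectors\<close>

definition sign_vector :: "nat \<Rightarrow> (nat \<times> bool) set \<Rightarrow> sign list" where
  "sign_vector n X =
     map (\<lambda>i. if (i, True) \<in> X then Plus else if (i, False) \<in> X then Minus else Zero) [0..<n]"

lemma length_sign_vector [simp]: "length (sign_vector n X) = n"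
  by (simp add: sign_vector_def)

lemma signed_sets_exclusive: "X \<in> signed_sets n \<Longrightarrow> (i, True) \<in> X \<Longrightarrow> (i, False) \<notin> X"
  by (auto simp: signed_sets_def)

lemma signed_sets_less: "X \<in> signed_sets n \<Longrightarrow> (i, b) \<in> X \<Longrightarrow> i < n"
  by (force simp: signed_sets_def)

lemma sign_vector_opp:
  assumes "X \<in> signed_sets n"
  shows "sign_vector n (opp ` X) = map flip (sign_vector n X)"
  using signed_sets_exclusive[OF assms] by (auto simp: sign_vector_def mem_opp_image)

lemma sign_vector_mono:
  assumes "X \<subseteq> Y" "Y \<in> signed_sets n"
  shows "list_all2 sign_le (sign_vector n X) (sign_vector n Y)"
proof -
  have "sign_le (sign_vector n X ! i) (sign_vector n Y ! i)" if "i < n" for i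
    using signed_sets_exclusive[OF assms(2), of i] subsetD[OF assms(1), of "(i, True)"]
      subsetD[OF assms(1), of "(i, False)"] that
    by (auto simp: sign_vector_def sign_le_def)
  then show ?thesis by (simp add: list_all2_conv_all_nth)
qed

lemma first_sign_sign_vector:
  assumes "X \<in> signed_sets n" "X \<noteq> {}"
  shows "first_sign (sign_vector n X) \<noteq> Zero"
proof -
  obtain i b where ib: "(i, b) \<in> X" using assms(2) by auto
  then have "i < n" using signed_sets_less assms(1) by blast
  with ib show ?thesis
    by (cases b) (auto simp: first_sign_eq_Zero_iff sign_vector_def image_subset_iff intro!: bexI[of _ i])
qed

text \<open>\<open>Suc\<close> translates the 0-based coordinates of signed sets into the 1-based
  indices on which \<open>\<sigma>\<close> acts.\<close>

lemma sign_set_sign_vector: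
  assumes "X \<in> signed_sets n"
  shows "sign_set (if b then Plus else Minus) (sign_vector n X) = Suc ` {i. (i, b) \<in> X}"
proof -
  have "j \<in> sign_set (if b then Plus else Minus) (sign_vector n X) \<longleftrightarrow> j \<in> Suc ` {i. (i, b) \<in> X}" for j
  proof (cases j)
    case (Suc i)
    show ?thesis
    proof (cases "i < n")
      case True
      then show ?thesis
        using signed_sets_exclusive[OF assms, of i] Suc
        by (auto simp: sign_set_def sign_vector_def split: if_splits)
    next
      case False
      then show ?thesis
        using signed_sets_less[OF assms, of i] Suc by (auto simp: sign_set_def)
    qed
  qed (auto simp: sign_set_def)
  then show ?thesis by blast
qed

text \<open>If one side had fewer than \<open>q\<close> edges, \<open>X\<close> would compete in the
  maximum defining \<open>salt\<close>, which is over a set bounded by \<open>n\<close>.\<close>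

lemma induced_edges_if_alt_gt_salt:
  assumes "length X = n" "alt X > salt n E \<sigma> q" "q \<ge> 1" "\<epsilon> \<in> {Plus, Minus}"
  shows "card (induced_edges E (\<sigma> ` sign_set \<epsilon> X)) \<ge> q"
proof (rule ccontr)
  assume "\<not> ?thesis"
  then have "min (card (induced_edges E (\<sigma> ` sign_set Plus X)))
                (card (induced_edges E (\<sigma> ` sign_set Minus X))) \<le> q - 1"
    using assms(4) by auto
  then have "alt X \<in> {alt X | X. length X = n \<and>
            min (card (induced_edges E (\<sigma> ` sign_set Plus X)))
                (card (induced_edges E (\<sigma> ` sign_set Minus X))) \<le> q - 1}" (is "_ \<in> ?A")
    using assms(1) by blast
  moreover have "finite ?A"
    by (rule finite_subset[of _ "{..n}"]) (auto intro: alt_le_length)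
  ultimately have "alt X \<le> salt n E \<sigma> q"
    unfolding salt_def by (intro Max_ge)
  then show False using assms(2) by simp
qed

section \<open>Colourings without a monochromatic complete bipartite subgraph\<close>

lemma exists_large_colour_class:
  fixes f :: "'a \<Rightarrow> nat"
  assumes "finite S" "f ` S \<subseteq> {..<C}" "card S > C * (t - 1)"
  shows "\<exists>j<C. t \<le> card {e \<in> S. f e = j}"
proof (rule ccontr)
  assume "\<not> ?thesis"
  then have small: "card {e \<in> S. f e = j} \<le> t - 1" if "j < C" for j using that by force
  have "card S = card (\<Union>j<C. {e \<in> S. f e = j})"
    using assms(2) by (intro arg_cong[where f = card]) auto
  also have "\<dots> \<le> (\<Sum>j<C. card {e \<in> S. f e = j})"
    by (rule card_UN_le) simp
  also have "\<dots> \<le> (\<Sum>j<C. t - 1)" using small by (intro sum_mono) auto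
  finally show False using assms(3) by simp
qed

lemma monochromatic_Ktt_if_disjoint:
  assumes "{} \<notin> E" "t \<ge> 1" "S \<inter> T = {}" "inj_on h (c ` E)"
    and "t \<le> card {e \<in> E. e \<subseteq> S \<and> h (c e) = j}"
    and "t \<le> card {e \<in> E. e \<subseteq> T \<and> h (c e) = j}"
  shows "\<exists>W1 W2. is_Ktt (KG E) t W1 W2 \<and> monochromatic c (W1 \<union> W2)"
proof -
  obtain W1 where W1: "W1 \<subseteq> {e \<in> E. e \<subseteq> S \<and> h (c e) = j}" "card W1 = t" "finite W1"
    using assms(5) by (rule obtain_subset_with_card_n)
  obtain W2 where W2: "W2 \<subseteq> {e \<in> E. e \<subseteq> T \<and> h (c e) = j}" "card W2 = t" "finite W2"
    using assms(6) by (rule obtain_subset_with_card_n)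
  have disj: "u \<inter> w = {}" if "u \<in> W1" "w \<in> W2" for u w
    using that W1 W2 assms(3) by blast
  have "{} \<notin> W1" using W1 assms(1) by blast
  \<comment> \<open>A common member would be disjoint from itself, hence the empty edge.\<close>
  then have "W1 \<inter> W2 = {}" using disj by (metis disjoint_iff inf.idem)
  moreover have "{u, w} \<in> snd (KG E)" if "u \<in> W1" "w \<in> W2" for u w
  proof -
    have "u \<in> E" "w \<in> E" using that W1 W2 by auto
    then show ?thesis using disj[OF that] by (auto simp: KG_def)
  qed
  ultimately have "is_Ktt (KG E) t W1 W2"
    using W1 W2 by (auto simp: is_Ktt_def KG_def)
  moreover have "monochromatic c (W1 \<union> W2)"
  proof -
    obtain w where w: "w \<in> W1" using W1(2) assms(2) by (cases "W1 = {}") auto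
    have "c v = c w" if "v \<in> W1 \<union> W2" for v
    proof (rule inj_onD[OF assms(4)])
      show "h (c v) = h (c w)" "c v \<in> c ` E" "c w \<in> c ` E" using that w W1 W2 by auto
    qed
    then show ?thesis unfolding monochromatic_def by blast
  qed
  ultimately show ?thesis by blast
qed

theorem theorem6:
  fixes V :: "'v set" and E :: "'v set set" and \<sigma> :: "nat \<Rightarrow> 'v"
    and n d q t :: nat and c :: "'v set \<Rightarrow> 'c"
  assumes "hypergraph V E" and "E \<noteq> {}" and "card V = n"
    and "bij_betw \<sigma> {1..n} V"
    and "d \<ge> 1" and "q \<ge> 1" and "t \<ge> 1"
    and "q \<ge> (d - 1) * (t - 1) + 1"
    and "\<nexists>W1 W2. is_Ktt (KG E) t W1 W2 \<and> monochromatic c (W1 \<union> W2)"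
  shows "int (card (c ` fst (KG E))) \<ge> min (int n - int (salt n E \<sigma> q) + 1) (int d)"
proof (rule ccontr)
  define C where "C = card (c ` E)"
  define s where "s = salt n E \<sigma> q"
  assume "\<not> ?thesis"
  then have "int C < int n - int s + 1" "C < d"
    by (auto simp: C_def s_def KG_def)
  then have Cn: "s + C \<le> n" and Cd: "C \<le> d - 1" by auto
  have finE: "finite E" and E: "{} \<notin> E"
    using assms(1) by (auto simp: hypergraph_def intro: finite_subset)
  then have C1: "C \<ge> 1" using assms(2) by (simp add: C_def Suc_le_eq card_gt_0_iff)
  \<comment> \<open>Colours are numbered from 0, so the largest of two different ones is at least
    1.\<close>
  obtain h where h: "bij_betw h (c ` E) {..<C}"
    using ex_bij_betw_finite_nat[of "c ` E"] finE by (auto simp: C_def atLeast0LessThan)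
  have h_less: "h (c e) < C" if "e \<in> E" for e using h that by (auto simp: bij_betw_def)
  define side where "side b X = \<sigma> ` Suc ` {i. (i, b) \<in> X}" for b :: bool and X
  define D where "D X b j \<longleftrightarrow> t \<le> card {e \<in> E. e \<subseteq> side b X \<and> h (c e) = j}" for X b j
  let ?alt = "\<lambda>X. alt (sign_vector n X)"
  \<comment> \<open>Used only for \<open>?alt X > s\<close>, where the set is nonempty by
    \<open>D_ex\<close> below.\<close>
  define M where "M X = Max {j. j < C \<and> (\<exists>b. D X b j)}" for X
  \<comment> \<open>On nonempty signed sets the two kinds of labels have disjoint magnitude ranges,
    \<open>1..s\<close> and \<open>s + 1..s + C - 1\<close>.\<close>
  define lab where "lab X = (if ?alt X \<le> s then (?alt X, first_sign (sign_vector n X) = Plus)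
      else (s + M X, D X True (M X)))" for X

  have D_mono: "D Y b j" if "D X b j" "X \<subseteq> Y" for X Y b j
  proof -
    have "side b X \<subseteq> side b Y" using that(2) by (auto simp: side_def)
    then have "card {e \<in> E. e \<subseteq> side b X \<and> h (c e) = j} \<le> card {e \<in> E. e \<subseteq> side b Y \<and> h (c e) = j}"
      using finE by (intro card_mono) auto
    then show ?thesis using that(1) by (simp add: D_def)
  qed
  have D_excl: "\<not> D X False j" if "X \<in> signed_sets n" "D X True j" for X j
  proof
    assume "D X False j"
    have "Suc ` {i. (i, b) \<in> X} \<subseteq> {1..n}" for b using signed_sets_less[OF that(1)] by fastforce
    then have "side True X \<inter> side False X
        = \<sigma> ` (Suc ` {i. (i, True) \<in> X} \<inter> Suc ` {i. (i, False) \<in> X})"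
      unfolding side_def using assms(4) by (metis bij_betw_def inj_on_image_Int)
    also have "\<dots> = {}" using signed_sets_exclusive[OF that(1)] by auto
    finally show False
      using monochromatic_Ktt_if_disjoint[OF E assms(7), of "side True X" "side False X" h c j]
        that(2) \<open>D X False j\<close> assms(9) h by (simp add: D_def bij_betw_def)
  qed
  have D_ex: "\<exists>j<C. D X b j" if "X \<in> signed_sets n" "?alt X > s" for X b
  proof -
    let ?S = "induced_edges E (side b X)"
    have "card ?S \<ge> q"
      using induced_edges_if_alt_gt_salt[of "sign_vector n X" n E \<sigma> q "if b then Plus else Minus"]
        that assms(6) by (simp only: sign_set_sign_vector s_def side_def) simp
    \<comment> \<open>Here fewer than \<open>d\<close> colours turns the bound on \<open>q\<close>
      into the pigeonhole condition.\<close>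
    moreover have "C * (t - 1) \<le> (d - 1) * (t - 1)" using Cd by simp
    ultimately have "card ?S > C * (t - 1)" using assms(8) by linarith
    then have "\<exists>j<C. t \<le> card {e \<in> ?S. h (c e) = j}"
      using finE h_less by (intro exists_large_colour_class) (auto simp: induced_edges_def)
    then show ?thesis by (simp add: D_def induced_edges_def)
  qed
  have D_opp: "D (opp ` X) b j = D X (\<not> b) j" for X b j
    by (simp add: D_def side_def mem_opp_image)
  have M_opp: "M (opp ` X) = M X" for X
  proof -
    have "(\<exists>b. D (opp ` X) b j) = (\<exists>b. D X b j)" for j by (auto simp: D_opp ex_bool_eq)
    then show ?thesis by (simp add: M_def)
  qed
  have M_ge: "j \<le> M X" if "j < C" "D X b j" for X b j
    unfolding M_def using that by (intro Max_ge) auto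
  have M_in: "M X < C \<and> (D X True (M X) \<or> D X False (M X))"
    if "X \<in> signed_sets n" "?alt X > s" for X
  proof -
    have "M X \<in> {j. j < C \<and> (\<exists>b. D X b j)}"
      unfolding M_def using D_ex[OF that, of True] by (intro Max_in) auto
    then show ?thesis by (auto simp: ex_bool_eq)
  qed
  \<comment> \<open>Each side has a large colour, and \<open>D_excl\<close> makes the two colours
    different; the larger is not 0.\<close>
  have M_pos: "M X \<ge> 1" if X: "X \<in> signed_sets n" "?alt X > s" for X
  proof -
    obtain i j where ij: "i < C" "D X True i" "j < C" "D X False j" using D_ex[OF X] by blast
    then have "i \<noteq> j" using D_excl[OF X(1)] by blast
    then show ?thesis using M_ge[OF ij(1,2)] M_ge[OF ij(3,4)] by linarith
  qed

  interpret tucker_labelling n lab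
  proof
    fix X assume X: "X \<in> signed_sets n" "X \<noteq> {}"
    have "(flip x = Plus) = (x \<noteq> Plus)" if "x \<noteq> Zero" for x using that by (cases x) auto
    then show "lab (opp ` X) = opp (lab X)"
      using first_sign_sign_vector[OF X] M_in[OF X(1)] D_excl[OF X(1)]
      by (auto simp: lab_def sign_vector_opp X alt_flip first_sign_flip M_opp D_opp)
  next
    fix X Y assume X: "X \<in> signed_sets n" "X \<noteq> {}" and Y: "Y \<in> signed_sets n" and XY: "X \<subseteq> Y"
    show "lab Y \<noteq> opp (lab X)"
    proof
      assume eq: "lab Y = opp (lab X)"
      have ne: "first_sign (sign_vector n X) \<noteq> Zero" "first_sign (sign_vector n Y) \<noteq> Zero"
        using first_sign_sign_vector X Y XY by auto
      consider "?alt X \<le> s" "?alt Y \<le> s" | "?alt X \<le> s" "?alt Y > s" | "?alt X > s" "?alt Y \<le> s"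
        | "?alt X > s" "?alt Y > s" by linarith
      then show False
      proof cases
        case 1
        \<comment> \<open>Opposite first signs would force \<open>alt\<close> to grow strictly from
          \<open>X\<close> to \<open>Y\<close>.\<close>
        then have "?alt X = ?alt Y" "first_sign (sign_vector n X) \<noteq> first_sign (sign_vector n Y)"
          using eq by (auto simp: lab_def)
        then show ?thesis
          using alt_less_if_first_sign_differs[OF sign_vector_mono[OF XY Y] ne] by simp
      next
        case 2
        then show ?thesis using eq M_pos[OF Y] by (simp add: lab_def)
      next
        case 3
        then show ?thesis using eq M_pos[OF X(1)] by (simp add: lab_def)
      next
        case 4
        \<comment> \<open>The common colour is large on some side of \<open>X\<close>, hence on the
          same side of \<open>Y\<close>, and by \<open>D_excl\<close> only there; so the signs
          agree.\<close>
        then have "M X = M Y" "D Y True (M X) = (\<not> D X True (M X))"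
          using eq by (auto simp: lab_def)
        then show ?thesis using M_in[OF X(1)] 4 D_mono[OF _ XY] D_excl[OF Y] by metis
      qed
    qed
  qed
  have "n \<le> s + C - 1"
  proof (rule octahedral_tucker)
    fix X assume X: "X \<in> signed_sets n" "X \<noteq> {}"
    show "fst (lab X) \<in> {1..s + C - 1}"
      using alt_pos[OF first_sign_sign_vector[OF X]] M_in[OF X(1)] M_pos[OF X(1)] C1
      by (auto simp: lab_def)
  qed
  then show False using Cn C1 by linarith
qed

end
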